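(* Each of $\mathsf{LTL}_{\mathsf{X},\wedge,\neg}[\{p\}]$, $\mathsf{LTL}_{\mathsf{F},\wedge,\neg}[\{p\}]$ and $\mathsf{LTL}_{\hat{\mathsf{F}},\wedge,\neg}[\{p\}]$ does not admit finite characterizations over $\mathcal{W}^{\mathsf{all}}$.
   Context: Words: for a countable ordinal $\alpha$, an $\alpha$-word over $\mathsf{AP}=\{p\}$ is a function $w:\alpha\to\mathcal{P}(\{p\})$; $|w|=\alpha$; for $\beta<|w|$, $w[\beta..]$ is the suffix $w'$ with $w'[\gamma]=w[\beta+\gamma]$. $\mathcal{W}^{\mathsf{all}}$ is the set of all words of countable ordinal length. Semantics: $w\models p$ iff $p\in w[0]$; $\neg,\land$ as usual; $w\models\mathsf{X}\varphi$ iff $|w|>1$ and $w[1..]\models\varphi$; $w\models\mathsf{F}\varphi$ iff there is $\alpha<|w|$ with $w[\alpha..]\models\varphi$; $\hat{\mathsf{F}}\varphi$ abbreviates $\mathsf{X}\mathsf{F}\varphi$. For a set $O$ of connectives, $\mathsf{LTL}_O[\{p\}]$ is the set of formulas built from $p$ using only the connectives in $O$. $[\![\varphi]\!]$ is the set of words in $\mathcal{W}^{\mathsf{all}}$ satisfying $\varphi$. A labeled example is $(w,\ell)$, $\ell\in\{+,-\}$; $\varphi$ fits it if ($w\models\varphi$ and $\ell=+$) or ($w\not\models\varphi$ and $\ell=-$). A fragment $\mathcal{L}$ admits finite characterizations over $\mathcal{W}^{\mathsf{all}}$ if for every $\varphi\in\mathcal{L}$ there is a finite set $E$ of labeled examples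 such that $\varphi$ fits $E$ and every $\psi\in\mathcal{L}$ fitting $E$ satisfies $[\![\psi]\!]=[\![\varphi]\!]$. *)

theory Defs
  imports "HOL-Library.FuncSet"
begin

text \<open>
  A countable ordinal is the isomorphism class of a well-order on a set of natural numbers.
  Well-orders are reflexive on their field, so the empty relation represents 0 and a
  reflexive singleton represents 1.
\<close>

quotient_type cord = "nat rel" / partial: "\<lambda>r s. (r, s) \<in> ordIso"
proof (rule part_equivpI)
  have "Well_order ({} :: nat rel)" by simp
  then show "\<exists>r :: nat rel. (r, r) \<in> ordIso"
    using ordIso_reflexive by blast
  show "symp (\<lambda>r s :: nat rel. (r, s) \<in> ordIso)"
    by (auto intro: sympI ordIso_symmetric)
  show "transp (\<lambda>r s :: nat rel. (r, s) \<in> ordIso)"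
    by (auto intro: transpI ordIso_transitive)
qed

text \<open>Ordered sum: a copy of \<open>r\<close> on the even numbers below a copy of \<open>s\<close> on the odd numbers.\<close>

definition osum :: "nat rel \<Rightarrow> nat rel \<Rightarrow> nat rel" where
  "osum r s = {(2 * x, 2 * y) | x y. (x, y) \<in> r}
            \<union> {(2 * x + 1, 2 * y + 1) | x y. (x, y) \<in> s}
            \<union> {(2 * x, 2 * y + 1) | x y. x \<in> Field r \<and> y \<in> Field s}"

lemma double_neq_Suc_double [simp]: "2 * x \<noteq> Suc (2 * y)" "Suc (2 * y) \<noteq> 2 * x" for x y :: nat
  by presburger+

lemma osum_simps [simp]:
  "(2 * x, 2 * y) \<in> osum r s \<longleftrightarrow> (x, y) \<in> r"
  "(Suc (2 * x), Suc (2 * y)) \<in> osum r s \<longleftrightarrow> (x, y) \<in> s"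
  "(2 * x, Suc (2 * y)) \<in> osum r s \<longleftrightarrow> x \<in> Field r \<and> y \<in> Field s"
  "(Suc (2 * x), 2 * y) \<notin> osum r s"
  by (auto simp: osum_def)

lemma nat_parity_cases:
  fixes x :: nat
  obtains y where "x = 2 * y" | y where "x = Suc (2 * y)"
  by (metis oddE evenE Suc_eq_plus1)

lemma Field_osum [simp]:
  "2 * x \<in> Field (osum r s) \<longleftrightarrow> x \<in> Field r"
  "Suc (2 * x) \<in> Field (osum r s) \<longleftrightarrow> x \<in> Field s"
proof -
  show "2 * x \<in> Field (osum r s) \<longleftrightarrow> x \<in> Field r"
  proof
    show "2 * x \<in> Field (osum r s) \<Longrightarrow> x \<in> Field r"
      by (auto simp: osum_def Field_def)
    show "x \<in> Field r \<Longrightarrow> 2 * x \<in> Field (osum r s)"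
      by (metis FieldI1 FieldI2 Field_iff osum_simps(1))
  qed
  show "Suc (2 * x) \<in> Field (osum r s) \<longleftrightarrow> x \<in> Field s"
  proof
    show "Suc (2 * x) \<in> Field (osum r s) \<Longrightarrow> x \<in> Field s"
      by (auto simp: osum_def Field_def)
    show "x \<in> Field s \<Longrightarrow> Suc (2 * x) \<in> Field (osum r s)"
      by (metis FieldI1 FieldI2 Field_iff osum_simps(2))
  qed
qed

lemma Well_order_least:
  assumes "Well_order r" "B \<subseteq> Field r" "B \<noteq> {}"
  shows "\<exists>a\<in>B. \<forall>b\<in>B. (a, b) \<in> r"
proof -
  have "Linear_order r"
    using assms(1) by (simp add: well_order_on_def)
  from Linear_order_Well_order_iff[OF this] show ?thesis
    using assms by simp
qed

lemma Well_order_osum: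
  assumes r: "Well_order r" and s: "Well_order s"
  shows "Well_order (osum r s)"
proof -
  let ?t = "osum r s"
  have *: "Refl r" "trans r" "antisym r" "Total r" "Refl s" "trans s" "antisym s" "Total s"
    using r s by (auto simp: order_on_defs)
  have "(x, x) \<in> ?t" if "x \<in> Field ?t" for x
    using that *(1,5) by (cases x rule: nat_parity_cases) (auto dest: refl_onD)
  then have "Refl ?t"
    by (rule refl_onI)
  moreover have "(x, z) \<in> ?t" if "(x, y) \<in> ?t" "(y, z) \<in> ?t" for x y z
    using that *(2,6)
    by (cases x rule: nat_parity_cases; cases y rule: nat_parity_cases; cases z rule: nat_parity_cases)
       (auto dest: transD intro: FieldI1 FieldI2)
  then have "trans ?t"
    by (rule transI)
  moreover have "x = y" if "(x, y) \<in> ?t" "(y, x) \<in> ?t" for x y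
    using that *(3,7) by (cases x rule: nat_parity_cases; cases y rule: nat_parity_cases) (auto dest: antisymD)
  then have "antisym ?t"
    by (rule antisymI)
  moreover have "(x, y) \<in> ?t \<or> (y, x) \<in> ?t" if "x \<in> Field ?t" "y \<in> Field ?t" "x \<noteq> y" for x y
    using that *(4,8) by (cases x rule: nat_parity_cases; cases y rule: nat_parity_cases) (auto simp: total_on_def)
  then have "Total ?t"
    by (simp add: total_on_def)
  ultimately have lin: "Linear_order ?t"
    by (auto simp: order_on_defs intro: FieldI1 FieldI2)
  have "\<exists>a\<in>A. \<forall>a'\<in>A. (a, a') \<in> ?t" if A: "A \<subseteq> Field ?t" "A \<noteq> {}" for A
  proof (cases "\<exists>x. 2 * x \<in> A")
    case True
    let ?B = "{x. 2 * x \<in> A}"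
    have "?B \<subseteq> Field r" "?B \<noteq> {}" using A True by auto
    then obtain a where "a \<in> ?B" "\<And>b. b \<in> ?B \<Longrightarrow> (a, b) \<in> r"
      using Well_order_least[OF r, of ?B] by blast
    then have "2 * a \<in> A" and a: "a \<in> Field r" "\<And>b. 2 * b \<in> A \<Longrightarrow> (a, b) \<in> r"
      using A by auto
    moreover have "(2 * a, a') \<in> ?t" if "a' \<in> A" for a'
      using that a A by (cases a' rule: nat_parity_cases) auto
    ultimately show ?thesis by blast
  next
    case False
    let ?B = "{x. Suc (2 * x) \<in> A}"
    have "?B \<subseteq> Field s" "?B \<noteq> {}" using A False by (auto, metis nat_parity_cases ex_in_conv subsetD)
    then obtain a where "a \<in> ?B" "\<And>b. b \<in> ?B \<Longrightarrow> (a, b) \<in> s"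
      using Well_order_least[OF s, of ?B] by blast
    then have "Suc (2 * a) \<in> A" and a: "\<And>b. Suc (2 * b) \<in> A \<Longrightarrow> (a, b) \<in> s"
      by auto
    moreover have "(Suc (2 * a), a') \<in> ?t" if "a' \<in> A" for a'
      using that a False by (cases a' rule: nat_parity_cases) auto
    ultimately show ?thesis by blast
  qed
  then show ?thesis
    using Linear_order_Well_order_iff[OF lin] by blast
qed

lemma ordIsoI:
  assumes "Well_order r" "Well_order s" "bij_betw f (Field r) (Field s)"
    and "\<And>x y. (x, y) \<in> r \<Longrightarrow> (f x, f y) \<in> s"
  shows "(r, s) \<in> ordIso"
  using assms iso_iff3[of r s f] by (auto simp: ordIso_def compat_def)

lemma ordIsoD:
  assumes "(r, s) \<in> ordIso"
  shows "Well_order r \<and> Well_order s \<and>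
    (\<exists>f. bij_betw f (Field r) (Field s) \<and> (\<forall>x y. (x, y) \<in> r \<longrightarrow> (f x, f y) \<in> s))"
  using assms iso_iff3[of r s] unfolding ordIso_def compat_def by blast

lemma osum_cong:
  assumes "(r, r') \<in> ordIso" "(s, s') \<in> ordIso"
  shows "(osum r s, osum r' s') \<in> ordIso"
proof -
  obtain f where f: "Well_order r" "Well_order r'" "bij_betw f (Field r) (Field r')"
    "\<And>x y. (x, y) \<in> r \<Longrightarrow> (f x, f y) \<in> r'"
    using ordIsoD[OF assms(1)] by blast
  obtain g where g: "Well_order s" "Well_order s'" "bij_betw g (Field s) (Field s')"
    "\<And>x y. (x, y) \<in> s \<Longrightarrow> (g x, g y) \<in> s'"
    using ordIsoD[OF assms(2)] by blast
  define h where "h x = (if even x then 2 * f (x div 2) else Suc (2 * g (x div 2)))" for x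
  have h [simp]: "h (2 * x) = 2 * f x" "h (Suc (2 * x)) = Suc (2 * g x)" for x
    by (auto simp: h_def)
  have "bij_betw h (Field (osum r s)) (Field (osum r' s'))"
    unfolding bij_betw_def
  proof
    have "x = y" if "x \<in> Field (osum r s)" "y \<in> Field (osum r s)" "h x = h y" for x y
      using that f(3) g(3)
      by (cases x rule: nat_parity_cases; cases y rule: nat_parity_cases) (auto simp: bij_betw_def inj_on_def)
    then show "inj_on h (Field (osum r s))"
      by (rule inj_onI)
    have "h x \<in> Field (osum r' s')" if "x \<in> Field (osum r s)" for x
      using that f(3) g(3) by (cases x rule: nat_parity_cases) (auto simp: bij_betw_def)
    moreover have "x \<in> h ` Field (osum r s)" if xf: "x \<in> Field (osum r' s')" for x
    proof (cases x rule: nat_parity_cases)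
      case (1 y)
      then obtain z where "z \<in> Field r" "y = f z"
        using xf f(3) by (auto simp: bij_betw_def)
      then show ?thesis using 1 by (intro image_eqI[of _ _ "2 * z"]) auto
    next
      case (2 y)
      then obtain z where "z \<in> Field s" "y = g z"
        using xf g(3) by (auto simp: bij_betw_def)
      then show ?thesis using 2 by (intro image_eqI[of _ _ "Suc (2 * z)"]) auto
    qed
    ultimately show "h ` Field (osum r s) = Field (osum r' s')" by blast
  qed
  moreover have "(h x, h y) \<in> osum r' s'" if "(x, y) \<in> osum r s" for x y
    using that f(3,4) g(3,4)
    by (cases x rule: nat_parity_cases; cases y rule: nat_parity_cases) (auto simp: bij_betw_def)
  ultimately show ?thesis
    using f(1,2) g(1,2) by (intro ordIsoI[of _ _ h] Well_order_osum) auto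
qed

lemma Well_order_singleton: "Well_order {(x, x)}"
  by (simp add: order_on_defs refl_on_def trans_def antisym_def total_on_def Field_def)

instantiation cord :: "{zero, one, plus, linorder}"
begin

lift_definition zero_cord :: cord is "{}"
  by (rule ordIso_reflexive) simp

lift_definition one_cord :: cord is "{(0, 0)}"
  by (rule ordIso_reflexive) (rule Well_order_singleton)

lift_definition plus_cord :: "cord \<Rightarrow> cord \<Rightarrow> cord" is osum
  by (rule osum_cong)

lift_definition less_eq_cord :: "cord \<Rightarrow> cord \<Rightarrow> bool" is "\<lambda>r s. (r, s) \<in> ordLeq"
  by (meson ordIso_ordLeq_trans ordIso_symmetric ordLeq_ordIso_trans)

lift_definition less_cord :: "cord \<Rightarrow> cord \<Rightarrow> bool" is "\<lambda>r s. (r, s) \<in> ordLess"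
  by (meson ordIso_ordLess_trans ordIso_symmetric ordLess_ordIso_trans)

instance
proof
  fix x y z :: cord
  show "x < y \<longleftrightarrow> x \<le> y \<and> \<not> y \<le> x"
    by transfer (metis ordIso_iff_ordLeq ordLeq_Well_order_simp not_ordLeq_iff_ordLess
        ordLess_imp_ordLeq)
  show "x \<le> x"
    by transfer (simp add: ordIso_iff_ordLeq)
  show "x \<le> y \<Longrightarrow> y \<le> z \<Longrightarrow> x \<le> z"
    by transfer (rule ordLeq_transitive)
  show "x \<le> y \<Longrightarrow> y \<le> x \<Longrightarrow> x = y"
    by transfer (simp add: ordIso_iff_ordLeq)
  show "x \<le> y \<or> y \<le> x"
    by transfer (meson ordIso_iff_ordLeq ordLeq_Well_order_simp ordLeq_total)
qed

end

lemma abs_cord_surj: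
  "\<exists>r. Well_order r \<and> a = abs_cord r"
proof (intro exI conjI)
  show "a = abs_cord (rep_cord a)"
    by (rule Quotient_abs_rep [OF Quotient_cord, symmetric])
  show "Well_order (rep_cord a)"
    using Quotient_rep_reflp [OF Quotient_cord, of a] by (simp add: ordIso_def)
qed

instance cord :: wellorder
proof
  fix P :: "cord \<Rightarrow> bool" and a
  assume step: "\<And>x. (\<And>y. y < x \<Longrightarrow> P y) \<Longrightarrow> P x"
  have "Well_order r \<longrightarrow> P (abs_cord r)" for r
  proof (induction r rule: wf_induct_rule[OF wf_ordLess])
    case (1 r)
    show ?case
    proof (rule impI, rule step)
      fix y assume r: "Well_order r" and y: "y < abs_cord r"
      obtain s where s: "Well_order s" "y = abs_cord s"
        using abs_cord_surj[of y] by blast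
      then have "(s, r) \<in> ordLess"
        using y r by (simp add: less_cord.abs_eq ordIso_reflexive)
      with 1 s show "P y" by blast
    qed
  qed
  moreover obtain r where "Well_order r" "a = abs_cord r"
    using abs_cord_surj[of a] by blast
  ultimately show "P a" by blast
qed

lemma cord_add_strict_mono_right:
  fixes \<alpha> \<beta> \<gamma> :: cord
  assumes "\<beta> < \<gamma>"
  shows "\<alpha> + \<beta> < \<alpha> + \<gamma>"
  using assms
proof transfer
  fix s t r :: "nat rel"
  assume rr: "(r, r) \<in> ordIso" and ss: "(s, s) \<in> ordIso" and tt: "(t, t) \<in> ordIso"
    and lt: "(s, t) \<in> ordLess"
  have wo: "Well_order r" "Well_order s" "Well_order t"
    using rr ss tt by (auto simp: ordIso_def)
  obtain a where a: "a \<in> Field t" "(s, Restr t (underS t a)) \<in> ordIso"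
    using lt ordLess_iff_ordIso_Restr[OF wo(3,2)] by blast
  have fld: "Field (Restr t (underS t a)) = underS t a"
    using wo(3) by (auto simp: order_on_defs Refl_Field_Restr underS_def intro: FieldI1)
  have U: "x \<in> underS q b \<longleftrightarrow> x \<noteq> b \<and> (x, b) \<in> q" for x b and q :: "nat rel"
    by (auto simp: underS_def)
  have "(x, y) \<in> osum r (Restr t (underS t a)) \<longleftrightarrow>
      (x, y) \<in> Restr (osum r t) (underS (osum r t) (Suc (2 * a)))" for x y
    using a(1)
    by (cases x rule: nat_parity_cases; cases y rule: nat_parity_cases)
       (auto simp: U fld intro: FieldI1 FieldI2)
  then have "osum r (Restr t (underS t a)) = Restr (osum r t) (underS (osum r t) (Suc (2 * a)))"
    by auto
  then have "(osum r s, Restr (osum r t) (underS (osum r t) (Suc (2 * a)))) \<in> ordIso"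
    using osum_cong[OF rr a(2)] by simp
  then show "(osum r s, osum r t) \<in> ordLess"
    using a(1) ordLess_iff_ordIso_Restr[of "osum r t" "osum r s"] wo Well_order_osum by force
qed

text \<open>Left subtraction is well defined; this justifies the length of a suffix below.\<close>

lemma cord_ex1_diff:
  fixes \<alpha> \<beta> :: cord
  assumes "\<beta> \<le> \<alpha>"
  shows "\<exists>!\<delta>. \<beta> + \<delta> = \<alpha>"
proof (rule ex_ex1I)
  show "\<delta> = \<delta>'" if "\<beta> + \<delta> = \<alpha>" "\<beta> + \<delta>' = \<alpha>" for \<delta> \<delta>'
    using that cord_add_strict_mono_right by (metis less_irrefl linorder_neq_iff)
  have "\<exists>\<delta>. (osum s \<delta>, r) \<in> ordIso \<and> (\<delta>, \<delta>) \<in> ordIso"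
    if rr: "(r, r) \<in> ordIso" and sr: "(s, r) \<in> ordLeq" for r s :: "nat rel"
  proof -
    have wo: "Well_order r" "Well_order s"
      using rr sr by (auto simp: ordLeq_def)
    obtain f where f: "embed s r f"
      using sr by (auto simp: ordLeq_def)
    let ?A = "f ` Field s"
    let ?d = "Restr r (Field r - ?A)"
    have of: "wo_rel.ofilter r ?A"
      using embed_Field_ofilter wo f by blast
    have inj: "inj_on f (Field s)"
      using embed_inj_on wo f by blast
    have cf: "\<And>x y. (x, y) \<in> s \<Longrightarrow> (f x, f y) \<in> r"
      using f embed_compat wo by (metis compat_def)
    have sub: "?A \<subseteq> Field r"
      using of by (auto simp: wo_rel.ofilter_def wo_rel_def wo)
    have down: "x \<in> ?A" if "(x, y) \<in> r" "y \<in> ?A" for x y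
      using of that by (force simp: wo_rel.ofilter_def wo_rel_def wo under_def)
    have wd: "Well_order ?d" using wo(1) by (rule Well_order_Restr)
    have fd: "Field ?d = Field r - ?A"
      using wo(1) by (auto simp: order_on_defs Refl_Field_Restr)
    have tot: "(x, y) \<in> r" if "x \<in> ?A" "y \<in> Field r - ?A" for x y
      using that sub down wo(1) unfolding order_on_defs total_on_def by (metis DiffD1 DiffD2 subsetD)
    define h where "h x = (if even x then f (x div 2) else x div 2)" for x
    have h [simp]: "h (2 * x) = f x" "h (Suc (2 * x)) = x" for x
      by (auto simp: h_def)
    have "x = y" if "x \<in> Field (osum s ?d)" "y \<in> Field (osum s ?d)" "h x = h y" for x y
      using that inj
      by (cases x rule: nat_parity_cases; cases y rule: nat_parity_cases) (auto simp: fd inj_on_def)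
    then have "inj_on h (Field (osum s ?d))"
      by (rule inj_onI)
    moreover have "h ` Field (osum s ?d) = Field r"
    proof
      have "h x \<in> Field r" if "x \<in> Field (osum s ?d)" for x
        using that sub by (cases x rule: nat_parity_cases) (auto simp: fd)
      then show "h ` Field (osum s ?d) \<subseteq> Field r" by blast
      show "Field r \<subseteq> h ` Field (osum s ?d)"
      proof
        fix x assume x: "x \<in> Field r"
        show "x \<in> h ` Field (osum s ?d)"
        proof (cases "x \<in> ?A")
          case True
          then obtain z where "z \<in> Field s" "x = f z" by blast
          then show ?thesis by (intro image_eqI[of _ _ "2 * z"]) auto
        next
          case False
          then show ?thesis using x by (intro image_eqI[of _ _ "Suc (2 * x)"]) (auto simp: fd)
        qed
      qed
    qed
    moreover have "(h x, h y) \<in> r" if "(x, y) \<in> osum s ?d" for x y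
      using that cf tot
      by (cases x rule: nat_parity_cases; cases y rule: nat_parity_cases) (auto simp: fd)
    ultimately have "(osum s ?d, r) \<in> ordIso"
      using wo wd by (intro ordIsoI[of _ _ h] Well_order_osum) (auto simp: bij_betw_def)
    then show ?thesis using wd ordIso_reflexive by blast
  qed
  then show "\<exists>\<delta>. \<beta> + \<delta> = \<alpha>"
    using assms by transfer blast
qed

text \<open>
  A word is its length \<open>\<alpha>\<close> together with a labelling of the ordinals below \<open>\<alpha>\<close>;
  outside its domain the labelling is \<open>undefined\<close>, so equality of words is the intended one.
\<close>

type_synonym 'a word = "cord \<times> (cord \<Rightarrow> 'a set)"

abbreviation wlen :: "'a word \<Rightarrow> cord" where
  "wlen w \<equiv> fst w"

abbreviation letter :: "'a word \<Rightarrow> cord \<Rightarrow> 'a set" where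
  "letter w \<equiv> snd w"

definition W_all :: "'a set \<Rightarrow> 'a word set" where
  "W_all AP = (SIGMA \<alpha>:UNIV. {..<\<alpha>} \<rightarrow>\<^sub>E Pow AP)"

definition suffix :: "'a word \<Rightarrow> cord \<Rightarrow> 'a word" where
  "suffix w \<beta> = (let \<delta> = (THE \<delta>. \<beta> + \<delta> = wlen w) in (\<delta>, \<lambda>\<gamma>\<in>{..<\<delta>}. letter w (\<beta> + \<gamma>)))"

datatype 'a ltl =
    Prop 'a
  | Neg "'a ltl"
  | And "'a ltl" "'a ltl"
  | Next "'a ltl"
  | Fut "'a ltl"

text \<open>The guard in the first clause only matters for the empty word, which has no letter at 0.\<close>

primrec sat :: "'a word \<Rightarrow> 'a ltl \<Rightarrow> bool" (infix "\<Turnstile>" 50) where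
  "w \<Turnstile> Prop p \<longleftrightarrow> 0 < wlen w \<and> p \<in> letter w 0"
| "w \<Turnstile> Neg \<phi> \<longleftrightarrow> \<not> w \<Turnstile> \<phi>"
| "w \<Turnstile> And \<phi> \<psi> \<longleftrightarrow> w \<Turnstile> \<phi> \<and> w \<Turnstile> \<psi>"
| "w \<Turnstile> Next \<phi> \<longleftrightarrow> 1 < wlen w \<and> suffix w 1 \<Turnstile> \<phi>"
| "w \<Turnstile> Fut \<phi> \<longleftrightarrow> (\<exists>\<alpha> < wlen w. suffix w \<alpha> \<Turnstile> \<phi>)"

abbreviation StrictFut :: "'a ltl \<Rightarrow> 'a ltl" where
  "StrictFut \<phi> \<equiv> Next (Fut \<phi>)"

datatype connective = NegC | AndC | NextC | FutC | StrictFutC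

inductive_set LTL :: "connective set \<Rightarrow> 'a set \<Rightarrow> 'a ltl set"
  for C :: "connective set" and AP :: "'a set" where
  LTL_Prop: "p \<in> AP \<Longrightarrow> Prop p \<in> LTL C AP"
| LTL_Neg: "NegC \<in> C \<Longrightarrow> \<phi> \<in> LTL C AP \<Longrightarrow> Neg \<phi> \<in> LTL C AP"
| LTL_And: "AndC \<in> C \<Longrightarrow> \<phi> \<in> LTL C AP \<Longrightarrow> \<psi> \<in> LTL C AP \<Longrightarrow> And \<phi> \<psi> \<in> LTL C AP"
| LTL_Next: "NextC \<in> C \<Longrightarrow> \<phi> \<in> LTL C AP \<Longrightarrow> Next \<phi> \<in> LTL C AP"
| LTL_Fut: "FutC \<in> C \<Longrightarrow> \<phi> \<in> LTL C AP \<Longrightarrow> Fut \<phi> \<in> LTL C AP"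
| LTL_StrictFut: "StrictFutC \<in> C \<Longrightarrow> \<phi> \<in> LTL C AP \<Longrightarrow> StrictFut \<phi> \<in> LTL C AP"

definition models :: "'a word set \<Rightarrow> 'a ltl \<Rightarrow> 'a word set" where
  "models W \<phi> = {w \<in> W. w \<Turnstile> \<phi>}"

datatype label = Positive | Negative

definition fits :: "'a ltl \<Rightarrow> ('a word \<times> label) set \<Rightarrow> bool" where
  "fits \<phi> E \<longleftrightarrow> (\<forall>(w, l) \<in> E. (w \<Turnstile> \<phi> \<and> l = Positive) \<or> (\<not> w \<Turnstile> \<phi> \<and> l = Negative))"

definition admits_finite_characterizations :: "'a ltl set \<Rightarrow> 'a word set \<Rightarrow> bool" where
  "admits_finite_characterizations L W \<longleftrightarrow>
     (\<forall>\<phi> \<in> L. \<exists>E. finite E \<and> E \<subseteq> W \<times> UNIV \<and> fits \<phi> E \<and>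
        (\<forall>\<psi> \<in> L. fits \<psi> E \<longrightarrow> models W \<psi> = models W \<phi>))"

end

theory Submission
  imports Defs
begin

text \<open>
  Suppose a fragment contains a decreasing sequence of formulas, no two consecutive ones of which
  are equivalent. The differences of consecutive formulas are then satisfiable and pairwise
  exclusive, so finitely many examples cannot tell all of them apart from the contradiction. For
  \<open>X\<close> and strict \<open>F\<close> the sequence bounds the length of the word from below, for \<open>F\<close> it bounds the
  number of alternations between \<open>p\<close> and its negation. Finite words suffice as witnesses.
\<close>

section \<open>Natural numbers as countable ordinals\<close>

lift_definition cord_of_nat :: "nat \<Rightarrow> cord" is natLeq_on
  by (rule ordIso_reflexive) (rule natLeq_on_Well_order)

lemma Field_natLeq_on_eq: "Field (natLeq_on n) = {..<n}"
  using Field_natLeq_on[of n] by auto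

lemma cord_of_nat_0 [simp]: "cord_of_nat 0 = 0"
  by (auto simp: cord_of_nat_def zero_cord_def)

lemma cord_of_nat_1: "cord_of_nat (Suc 0) = 1"
proof -
  have "natLeq_on (Suc 0) = {(0, 0)}" by auto
  then show ?thesis by (simp add: cord_of_nat_def one_cord_def)
qed

lemma cord_of_nat_add: "cord_of_nat (m + n) = cord_of_nat m + cord_of_nat n"
proof (rule sym, transfer)
  fix m n :: nat
  \<comment> \<open>\<open>h\<close> undoes the coding of \<open>osum\<close>: evens carry the first
    summand, odds carry the second, shifted past \<open>m\<close>.\<close>
  define h where "h x = (if even x then x div 2 else m + x div 2)" for x :: nat
  have h [simp]: "h (2 * x) = x" "h (Suc (2 * x)) = m + x" for x
    by (auto simp: h_def)
  let ?o = "osum (natLeq_on m) (natLeq_on n)"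
  show "(?o, natLeq_on (m + n)) \<in> ordIso"
  proof (rule ordIsoI)
    show "Well_order ?o" "Well_order (natLeq_on (m + n))"
      by (auto intro: Well_order_osum natLeq_on_Well_order)
    show "bij_betw h (Field ?o) (Field (natLeq_on (m + n)))"
      unfolding bij_betw_def
    proof
      have "x = y" if "x \<in> Field ?o" "y \<in> Field ?o" "h x = h y" for x y
        using that by (cases x rule: nat_parity_cases; cases y rule: nat_parity_cases)
          (auto simp: Field_natLeq_on_eq)
      then show "inj_on h (Field ?o)" by (rule inj_onI)
      have "h x < m + n" if "x \<in> Field ?o" for x
        using that by (cases x rule: nat_parity_cases) (auto simp: Field_natLeq_on_eq)
      moreover have "x \<in> h ` Field ?o" if "x < m + n" for x
      proof (cases "x < m")
        case True
        then show ?thesis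
          by (intro image_eqI[of _ _ "2 * x"]) (auto simp: Field_natLeq_on_eq)
      next
        case False
        then show ?thesis using that
          by (intro image_eqI[of _ _ "Suc (2 * (x - m))"]) (auto simp: Field_natLeq_on_eq)
      qed
      ultimately show "h ` Field ?o = Field (natLeq_on (m + n))"
        by (auto simp: Field_natLeq_on_eq)
    qed
    show "(h x, h y) \<in> natLeq_on (m + n)" if "(x, y) \<in> ?o" for x y
      using that by (cases x rule: nat_parity_cases; cases y rule: nat_parity_cases)
        (auto simp: Field_natLeq_on_eq)
  qed
qed

text \<open>The proper initial segments of \<open>natLeq_on n\<close> are the
  \<open>natLeq_on m\<close> with m < n. Thus quantifying over positions of a finite word is
  quantifying over natural numbers.\<close>

lemma less_cord_of_nat_iff: "\<alpha> < cord_of_nat n \<longleftrightarrow> (\<exists>m<n. \<alpha> = cord_of_nat m)"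
proof transfer
  fix r :: "nat rel" and n
  assume "(r, r) \<in> ordIso"
  then have r: "Well_order r" by (auto simp: ordIso_def)
  have "Restr (natLeq_on n) (underS (natLeq_on n) m) = natLeq_on m" if "m < n" for m
    using that by (auto simp: underS_def)
  then show "(r, natLeq_on n) \<in> ordLess \<longleftrightarrow> (\<exists>m<n. (r, natLeq_on m) \<in> ordIso)"
    using ordLess_iff_ordIso_Restr[OF natLeq_on_Well_order r, of n]
    by (auto simp: Field_natLeq_on_eq)
qed

lemma cord_of_nat_less_iff [simp]: "cord_of_nat m < cord_of_nat n \<longleftrightarrow> m < n"
  by (metis less_cord_of_nat_iff less_imp_not_less linorder_neqE_nat less_irrefl)

lemma cord_of_nat_eq_iff [simp]: "cord_of_nat m = cord_of_nat n \<longleftrightarrow> m = n"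
  by (metis cord_of_nat_less_iff less_irrefl linorder_neqE_nat)

lemma the_cord_of_nat [simp]: "(THE n. cord_of_nat m = cord_of_nat n) = m"
  by auto

section \<open>Finite words as lists\<close>

text \<open>Every position below the length is \<open>cord_of_nat n\<close> for exactly one
  \<open>n\<close>, which \<open>THE\<close> recovers as a list index.\<close>

definition list_word :: "'a set list \<Rightarrow> 'a word" where
  "list_word xs = (cord_of_nat (length xs),
     \<lambda>\<gamma>\<in>{..<cord_of_nat (length xs)}. xs ! (THE n. \<gamma> = cord_of_nat n))"

lemma list_word_in_W_all: "set xs \<subseteq> Pow AP \<Longrightarrow> list_word xs \<in> W_all AP"
  using nth_mem by (fastforce simp: list_word_def W_all_def less_cord_of_nat_iff)

lemma suffix_list_word:
  assumes "k \<le> length xs"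
  shows "suffix (list_word xs) (cord_of_nat k) = list_word (drop k xs)"
proof -
  have "cord_of_nat k + cord_of_nat (length xs - k) = cord_of_nat (length xs)"
    using assms by (simp flip: cord_of_nat_add)
  \<comment> \<open>Left subtraction is unique because addition is strictly monotone on the
    right.\<close>
  then have "(THE \<delta>. cord_of_nat k + \<delta> = cord_of_nat (length xs)) = cord_of_nat (length xs - k)"
    by (intro the_equality) (auto, metis cord_add_strict_mono_right less_irrefl linorder_neqE)
  moreover have "letter (list_word xs) (cord_of_nat k + \<gamma>) = drop k xs ! (THE n. \<gamma> = cord_of_nat n)"
    if less: "\<gamma> < cord_of_nat (length xs - k)" for \<gamma>
  proof -
    obtain m where "m < length xs - k" "\<gamma> = cord_of_nat m"
      using less by (auto simp: less_cord_of_nat_iff)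
    moreover from this have "k + m < length xs" by simp
    ultimately show ?thesis
      by (simp add: list_word_def flip: cord_of_nat_add)
  qed
  ultimately show ?thesis
    by (auto simp: suffix_def list_word_def Let_def cong: restrict_cong)
qed

lemma list_word_Prop_iff: "list_word xs \<Turnstile> Prop p \<longleftrightarrow> xs \<noteq> [] \<and> p \<in> hd xs"
  by (cases xs) (simp_all add: list_word_def less_cord_of_nat_iff flip: cord_of_nat_0)

lemma list_word_Next_iff: "list_word xs \<Turnstile> Next \<phi> \<longleftrightarrow> 1 < length xs \<and> list_word (tl xs) \<Turnstile> \<phi>"
  using suffix_list_word[of 1 xs]
  by (auto simp: list_word_def drop_Suc simp flip: cord_of_nat_1)

lemma list_word_Fut_iff:
  "list_word xs \<Turnstile> Fut \<phi> \<longleftrightarrow> (\<exists>k<length xs. list_word (drop k xs) \<Turnstile> \<phi>)"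
  by (auto simp: less_cord_of_nat_iff suffix_list_word list_word_def[of xs, THEN arg_cong[of _ _ fst]])

section \<open>Criterion for the failure of finite characterizations\<close>

lemma not_admits_finite_characterizations:
  assumes "\<phi> \<in> L" "\<And>w. \<not> w \<Turnstile> \<phi>"
    and \<psi>: "\<And>n. And (\<psi> n) (Neg (\<psi> (Suc n))) \<in> L"
    and mono: "\<And>n w. w \<Turnstile> \<psi> (Suc n) \<Longrightarrow> w \<Turnstile> \<psi> n"
    and sep: "\<And>n. \<exists>w\<in>W. w \<Turnstile> \<psi> n \<and> \<not> w \<Turnstile> \<psi> (Suc n)"
  shows "\<not> admits_finite_characterizations L W"
proof
  assume "admits_finite_characterizations L W"
  then obtain E where E: "finite E" "fits \<phi> E"
    "\<And>\<chi>. \<chi> \<in> L \<Longrightarrow> fits \<chi> E \<Longrightarrow> models W \<chi> = models W \<phi>"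
    using assms(1) unfolding admits_finite_characterizations_def by metis
  \<comment> \<open>No word satisfies the contradiction \<open>\<phi>\<close>, so it fits only
    negative examples.\<close>
  have neg: "l = Negative" if "(w, l) \<in> E" for w l
    using E(2) that assms(2) by (auto simp: fits_def)
  \<comment> \<open>Otherwise the n-th difference fits \<open>E\<close> and would be equivalent to
    \<open>\<phi>\<close>, although \<open>sep\<close> provides a model of it.\<close>
  have "\<exists>w\<in>fst ` E. w \<Turnstile> \<psi> n \<and> \<not> w \<Turnstile> \<psi> (Suc n)" for n
  proof (rule ccontr)
    assume "\<not> ?thesis"
    then have "fits (And (\<psi> n) (Neg (\<psi> (Suc n)))) E"
      using neg by (force simp: fits_def)
    from E(3)[OF \<psi> this] show False
      using sep[of n] assms(2) by (auto simp: models_def)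
  qed
  then obtain g where g: "\<And>n. g n \<in> fst ` E" "\<And>n. g n \<Turnstile> \<psi> n" "\<And>n. \<not> g n \<Turnstile> \<psi> (Suc n)"
    by metis
  have antimono: "w \<Turnstile> \<psi> n \<Longrightarrow> w \<Turnstile> \<psi> m" if "m \<le> n" for w m n
    using that by (induction rule: dec_induct) (auto intro: mono)
  \<comment> \<open>For m < n the word \<open>g n\<close> satisfies \<open>\<psi> n\<close>, hence
    \<open>\<psi> (Suc m)\<close>, which \<open>g m\<close> violates.\<close>
  have "inj g"
    by (rule linorder_injI) (metis antimono g(2,3) Suc_leI)
  moreover have "finite (range g)"
    using E(1) g(1) by (meson finite_imageI finite_subset image_subsetI)
  ultimately show False
    using finite_imageD by blast
qed

text \<open>Iterating a monotone operator from a tautology yields a decreasing sequence: the first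
  step down is trivial, and monotonicity carries it to all later ones. The grammar has no constant
  for truth, so \<open>verum\<close> is built from \<open>p\<close>.\<close>

lemma not_admits_finite_characterizations_funpow:
  fixes p :: 'a
  defines "verum \<equiv> Neg (And (Prop p) (Neg (Prop p)))"
  assumes C: "{AndC, NegC} \<subseteq> C" and "p \<in> AP"
    and M: "\<And>\<phi>. \<phi> \<in> LTL C AP \<Longrightarrow> M \<phi> \<in> LTL C AP"
    and mono: "\<And>\<phi> \<phi>' w. (\<And>v. v \<Turnstile> \<phi> \<Longrightarrow> v \<Turnstile> \<phi>') \<Longrightarrow> w \<Turnstile> M \<phi> \<Longrightarrow> w \<Turnstile> M \<phi>'"
    and sep: "\<And>n. \<exists>w\<in>W. w \<Turnstile> (M ^^ n) verum \<and> \<not> w \<Turnstile> (M ^^ Suc n) verum"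
  shows "\<not> admits_finite_characterizations (LTL C AP) W"
proof (rule not_admits_finite_characterizations[where \<psi> = "\<lambda>n. (M ^^ n) verum"])
  have verum: "verum \<in> LTL C AP"
    using C \<open>p \<in> AP\<close> unfolding verum_def by (auto intro!: LTL.intros)
  then show "Neg verum \<in> LTL C AP" using C by (auto intro: LTL_Neg)
  show "\<not> w \<Turnstile> Neg verum" for w by (simp add: verum_def)
  have "(M ^^ n) verum \<in> LTL C AP" for n
    by (induction n) (auto intro: verum M)
  from this this[of "Suc _"] show "And ((M ^^ n) verum) (Neg ((M ^^ Suc n) verum)) \<in> LTL C AP" for n
    using C by (intro LTL_And LTL_Neg) auto
  show "w \<Turnstile> (M ^^ Suc n) verum \<Longrightarrow> w \<Turnstile> (M ^^ n) verum" for n w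
  proof (induction n arbitrary: w)
    case 0
    then show ?case by (simp add: verum_def)
  next
    case (Suc n)
    then show ?case using mono[of "(M ^^ Suc n) verum" "(M ^^ n) verum" w] by simp
  qed
qed (rule sep)

section \<open>Formulas measuring the length of a word\<close>

text \<open>Each \<open>Next\<close> consumes one letter and demands another after it. The case n =
  0 is separate because a tautology holds on the empty word too.\<close>

lemma list_word_Next_funpow_iff:
  assumes "\<And>w. w \<Turnstile> \<phi>"
  shows "list_word xs \<Turnstile> (Next ^^ n) \<phi> \<longleftrightarrow> n = 0 \<or> n < length xs"
  by (induction n arbitrary: xs) (auto simp: assms list_word_Next_iff simp del: sat.simps)

lemma list_word_StrictFut_funpow_iff:
  assumes "\<And>w. w \<Turnstile> \<phi>"
  shows "list_word xs \<Turnstile> ((\<lambda>\<chi>. StrictFut \<chi>) ^^ n) \<phi> \<longleftrightarrow> n = 0 \<or> n < length xs"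
proof (induction n arbitrary: xs)
  case 0
  show ?case by (simp add: assms)
next
  case (Suc n)
  show ?case
    \<comment> \<open>Jumping further only shortens the remaining word, so the immediate successor,
      at offset 0 of the tail, is the best choice.\<close>
    by (auto simp: Suc list_word_Next_iff list_word_Fut_iff simp del: sat.simps intro!: exI[of _ 0])
qed

section \<open>Formulas counting alternations\<close>

text \<open>\<open>Fut\<close> may stay in place, so nesting it alone gains nothing. Asking for
  \<open>p\<close> and then for its negation forces a strict move.\<close>

definition alternation :: "'a \<Rightarrow> 'a ltl \<Rightarrow> 'a ltl" where
  "alternation p \<phi> = Fut (And (Prop p) (Fut (And (Neg (Prop p)) \<phi>)))"

definition alternating_list :: "'a \<Rightarrow> nat \<Rightarrow> 'a set list" where
  "alternating_list p n = map (\<lambda>i. if even i then {p} else {}) [0..<2 * n]"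

lemma list_word_drop_alternating_Prop_iff:
  "list_word (drop j (alternating_list p n)) \<Turnstile> Prop p \<longleftrightarrow> j < 2 * n \<and> even j"
  unfolding list_word_Prop_iff
  by (cases "j < 2 * n") (auto simp: alternating_list_def hd_drop_conv_nth)

text \<open>Absolute positions replace offsets, so that nested \<open>Fut\<close> all speak about
  suffixes of one fixed list.\<close>

lemma list_word_drop_alternating_Fut_iff:
  "list_word (drop j (alternating_list p n)) \<Turnstile> Fut \<phi> \<longleftrightarrow>
    (\<exists>k<2 * n. j \<le> k \<and> list_word (drop k (alternating_list p n)) \<Turnstile> \<phi>)"
proof
  have [simp]: "length (alternating_list p n) = 2 * n" by (simp add: alternating_list_def)
  {
    assume "list_word (drop j (alternating_list p n)) \<Turnstile> Fut \<phi>"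
    then obtain i where "i < 2 * n - j" "list_word (drop (i + j) (alternating_list p n)) \<Turnstile> \<phi>"
      by (auto simp: list_word_Fut_iff simp del: sat.simps)
    then show "\<exists>k<2 * n. j \<le> k \<and> list_word (drop k (alternating_list p n)) \<Turnstile> \<phi>"
      by (intro exI[of _ "i + j"]) simp
  next
    assume "\<exists>k<2 * n. j \<le> k \<and> list_word (drop k (alternating_list p n)) \<Turnstile> \<phi>"
    then obtain k where "k < 2 * n" "j \<le> k" "list_word (drop k (alternating_list p n)) \<Turnstile> \<phi>"
      by blast
    then show "list_word (drop j (alternating_list p n)) \<Turnstile> Fut \<phi>"
      unfolding list_word_Fut_iff by (intro exI[of _ "k - j"]) simp
  }
qed

text \<open>Each alternation uses up one even and one later odd position. All suffixes are covered
  because the inner formula is read at a later position.\<close>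

lemma list_word_alternation_funpow_iff:
  assumes "\<And>w. w \<Turnstile> \<phi>" "j \<le> 2 * n"
  shows "list_word (drop j (alternating_list p n)) \<Turnstile> (alternation p ^^ m) \<phi> \<longleftrightarrow> j + 2 * m \<le> 2 * n"
  using assms(2)
proof (induction m arbitrary: j)
  case 0
  then show ?case by (simp add: assms)
next
  case (Suc m)
  let ?w = "\<lambda>j. list_word (drop j (alternating_list p n))"
  \<comment> \<open>The bound on \<open>l\<close> matters: the empty suffix also satisfies
    \<open>Neg (Prop p)\<close>.\<close>
  have odd: "?w l \<Turnstile> And (Neg (Prop p)) ((alternation p ^^ m) \<phi>) \<longleftrightarrow> odd l \<and> l + 2 * m \<le> 2 * n"
    if "l < 2 * n" for l
    using Suc.IH[of l] that
    by (simp only: sat.simps(2,3) list_word_drop_alternating_Prop_iff less_imp_le simp_thms)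
  have even: "?w k \<Turnstile> And (Prop p) (Fut (And (Neg (Prop p)) ((alternation p ^^ m) \<phi>))) \<longleftrightarrow>
      even k \<and> (\<exists>l<2 * n. k \<le> l \<and> odd l \<and> l + 2 * m \<le> 2 * n)" if "k < 2 * n" for k
    unfolding sat.simps(3)[of _ "Prop p"] list_word_drop_alternating_Prop_iff
      list_word_drop_alternating_Fut_iff
    using that odd by blast
  have "?w j \<Turnstile> (alternation p ^^ Suc m) \<phi> \<longleftrightarrow>
      (\<exists>k<2 * n. j \<le> k \<and> even k \<and> (\<exists>l<2 * n. k \<le> l \<and> odd l \<and> l + 2 * m \<le> 2 * n))"
    unfolding funpow.simps o_apply alternation_def[of p "(alternation p ^^ m) \<phi>"]
      list_word_drop_alternating_Fut_iff
    using even by blast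
  also have "\<dots> \<longleftrightarrow> j + 2 * Suc m \<le> 2 * n"
  proof
    assume "\<exists>k<2 * n. j \<le> k \<and> even k \<and> (\<exists>l<2 * n. k \<le> l \<and> odd l \<and> l + 2 * m \<le> 2 * n)"
    then obtain k l where "j \<le> k" "even k" "k \<le> l" "odd l" "l + 2 * m \<le> 2 * n" by blast
    \<comment> \<open>The inner formula is read at \<open>l\<close> itself, not after it. As
      \<open>l\<close> is odd, parity sharpens its bound to l + 1 + 2 * m \<le> 2 * n, and j + 1
      \<le> l.\<close>
    then show "j + 2 * Suc m \<le> 2 * n" by presburger
  next
    assume j: "j + 2 * Suc m \<le> 2 * n"
    \<comment> \<open>The first even position from \<open>j\<close> on; the odd position following
      it serves as \<open>l\<close>.\<close>
    define k where "k = (if even j then j else Suc j)"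
    have "even k" "j \<le> k" "Suc k + 2 * m \<le> 2 * n"
      using j unfolding k_def by presburger+
    then show "\<exists>k<2 * n. j \<le> k \<and> even k \<and> (\<exists>l<2 * n. k \<le> l \<and> odd l \<and> l + 2 * m \<le> 2 * n)"
      by (intro exI[of _ k] conjI exI[of _ "Suc k"]; presburger)
  qed
  finally show ?case .
qed

theorem theorem18:
  fixes p :: 'a
  shows "\<not> admits_finite_characterizations (LTL {NextC, AndC, NegC} {p}) (W_all {p})
       \<and> \<not> admits_finite_characterizations (LTL {FutC, AndC, NegC} {p}) (W_all {p})
       \<and> \<not> admits_finite_characterizations (LTL {StrictFutC, AndC, NegC} {p}) (W_all {p})"
proof -
  define verum where "verum = Neg (And (Prop p) (Neg (Prop p)))"
  have verum: "w \<Turnstile> verum" for w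
    by (simp add: verum_def)
  \<comment> \<open>With n + 1 letters, n nested steps succeed and n + 1 fail.\<close>
  have repl: "list_word (replicate (Suc n) {p}) \<in> W_all {p}" for n
    by (rule list_word_in_W_all) auto
  have alt: "list_word (alternating_list p n) \<in> W_all {p}" for n
    by (rule list_word_in_W_all) (auto simp: alternating_list_def)
  have "\<not> admits_finite_characterizations (LTL {NextC, AndC, NegC} {p}) (W_all {p})"
  proof (rule not_admits_finite_characterizations_funpow[where M = Next and p = p, folded verum_def])
    show "\<exists>w\<in>W_all {p}. w \<Turnstile> (Next ^^ n) verum \<and> \<not> w \<Turnstile> (Next ^^ Suc n) verum" for n
      using list_word_Next_funpow_iff[OF verum, of "replicate (Suc n) {p}"]
      by (intro bexI[OF _ repl[of n]]) (simp del: funpow.simps)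
  qed (auto intro: LTL.intros)
  moreover have "\<not> admits_finite_characterizations (LTL {FutC, AndC, NegC} {p}) (W_all {p})"
  proof (rule not_admits_finite_characterizations_funpow[where M = "alternation p" and p = p, folded verum_def])
    show "\<exists>w\<in>W_all {p}. w \<Turnstile> (alternation p ^^ n) verum \<and> \<not> w \<Turnstile> (alternation p ^^ Suc n) verum" for n
      \<comment> \<open>At position 0 the criterion reads 2 * m \<le> 2 * n, true for m = n and
        false for m = n + 1.\<close>
      using list_word_alternation_funpow_iff[OF verum, of 0 n p]
      by (intro bexI[OF _ alt[of n]]) (simp del: funpow.simps)
    show "alternation p \<phi> \<in> LTL {FutC, AndC, NegC} {p}" if "\<phi> \<in> LTL {FutC, AndC, NegC} {p}" for \<phi>
      using that unfolding alternation_def by (auto intro!: LTL.intros)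
  qed (simp_all add: alternation_def, blast)
  moreover have "\<not> admits_finite_characterizations (LTL {StrictFutC, AndC, NegC} {p}) (W_all {p})"
  proof (rule not_admits_finite_characterizations_funpow[where M = "\<lambda>\<phi>. StrictFut \<phi>" and p = p,
        folded verum_def])
    show "\<exists>w\<in>W_all {p}. w \<Turnstile> ((\<lambda>\<phi>. StrictFut \<phi>) ^^ n) verum \<and> \<not> w \<Turnstile> ((\<lambda>\<phi>. StrictFut \<phi>) ^^ Suc n) verum" for n
      using list_word_StrictFut_funpow_iff[OF verum, of "replicate (Suc n) {p}"]
      by (intro bexI[OF _ repl[of n]]) (simp del: funpow.simps)
  qed (simp_all add: LTL_StrictFut, blast)
  ultimately show ?thesis by blast
qed

end
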